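(* Let $\lambda\in(0,1)$ and $\epsilon>0$. For the proportional majority process, and likewise for the proportional minority process, with parameter $\lambda$, there exist a constant $c>0$ and, for all sufficiently large $n$, a graph with at most $n$ vertices, an initial coloring, and a sequence of at least $c\,n^{1+\widehat{f}(\lambda)-\epsilon}$ switches such that each switched node is switchable at the moment it switches, where $\widehat{f}(\lambda)=\max_{\varphi\in(0,\frac{1-\lambda}{2}]}\frac{\log\left(\frac{1-\varphi}{\lambda+\varphi}\right)}{\log\left(\frac{1-\varphi}{\varphi}\cdot\frac{1+\lambda}{1-\lambda}\right)}$.
   Context: For a coloring of a graph with colors black/white, an edge $\{u,v\}$ is a conflict in the majority process if $u,v$ have different colors, and in the minority process if they have the same color. $N_c(v)$ is the set of neighbors joined to $v$ by a conflict. Proportional switching rule with parameter $\lambda\in(0,1)$: $v$ is switchable iff $|N_c(v)|\ge\frac{1+\lambda}{2}\deg(v)$; switching flips the color of $v$; one node switches per step. *)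

theory Defs
  imports Complex_Main
begin

definition simple_graph :: "'a set \<Rightarrow> 'a set set \<Rightarrow> bool" where
  "simple_graph V E \<longleftrightarrow> finite V \<and> (\<forall>e\<in>E. \<exists>u\<in>V. \<exists>v\<in>V. u \<noteq> v \<and> e = {u, v})"

definition neighbors :: "'a set set \<Rightarrow> 'a \<Rightarrow> 'a set" where
  "neighbors E v = {u. {u, v} \<in> E}"

definition degree :: "'a set set \<Rightarrow> 'a \<Rightarrow> nat" where
  "degree E v = card (neighbors E v)"

datatype color = Black | White

primrec opposite :: "color \<Rightarrow> color" where
  "opposite Black = White"
| "opposite White = Black"

datatype process = Majority | Minority

text \<open>Only meaningful for adjacent \<open>u\<close> and \<open>v\<close>; adjacency is imposed in
  \<open>conflict_neighbors\<close>.\<close>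

primrec conflict :: "process \<Rightarrow> ('a \<Rightarrow> color) \<Rightarrow> 'a \<Rightarrow> 'a \<Rightarrow> bool" where
  "conflict Majority col u v \<longleftrightarrow> col u \<noteq> col v"
| "conflict Minority col u v \<longleftrightarrow> col u = col v"

definition conflict_neighbors ::
    "process \<Rightarrow> 'a set set \<Rightarrow> ('a \<Rightarrow> color) \<Rightarrow> 'a \<Rightarrow> 'a set" where
  "conflict_neighbors P E col v = {u \<in> neighbors E v. conflict P col u v}"

text \<open>Pitfall: a vertex of degree 0 satisfies this inequality vacuously and could be switched
  forever, so lower bounds on the number of switches are only interesting on graphs without
  isolated vertices.\<close>

definition switchable ::
    "process \<Rightarrow> real \<Rightarrow> 'a set set \<Rightarrow> ('a \<Rightarrow> color) \<Rightarrow> 'a \<Rightarrow> bool" where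
  "switchable P lam E col v \<longleftrightarrow>
     real (card (conflict_neighbors P E col v)) \<ge> (1 + lam) / 2 * real (degree E v)"

definition switch :: "('a \<Rightarrow> color) \<Rightarrow> 'a \<Rightarrow> ('a \<Rightarrow> color)" where
  "switch col v = col(v := opposite (col v))"

text \<open>The list contains the switched nodes in chronological order, starting from the
  coloring \<open>col\<close>.\<close>

primrec valid_switches ::
    "process \<Rightarrow> real \<Rightarrow> 'a set \<Rightarrow> 'a set set \<Rightarrow> ('a \<Rightarrow> color) \<Rightarrow> 'a list \<Rightarrow> bool" where
  "valid_switches P lam V E col [] \<longleftrightarrow> True"
| "valid_switches P lam V E col (v # vs) \<longleftrightarrow>
     v \<in> V \<and> switchable P lam E col v \<and> valid_switches P lam V E (switch col v) vs"

definition exponent_ratio :: "real \<Rightarrow> real \<Rightarrow> real" where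
  "exponent_ratio lam phi =
     ln ((1 - phi) / (lam + phi)) / ln ((1 - phi) / phi * ((1 + lam) / (1 - lam)))"

text \<open>\<open>Max\<close> is only specified on finite sets, hence the maximum is expressed by
  \<open>GREATEST\<close>; \<open>f_hat_is_maximum\<close> below shows that it is attained.\<close>

definition f_hat :: "real \<Rightarrow> real" where
  "f_hat lam = (GREATEST y. y \<in> exponent_ratio lam ` {0<..(1 - lam) / 2})"

lemma exponent_ratio_denominator_pos:
  fixes lam phi :: real
  assumes "0 < lam" "lam < 1" "0 < phi" "phi \<le> (1 - lam) / 2"
  shows "ln ((1 - phi) / phi * ((1 + lam) / (1 - lam))) > 0"
proof -
  have "1 < (1 - phi) / phi" "1 < (1 + lam) / (1 - lam)"
    using assms by (auto simp: field_simps)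
  then have "1 < (1 - phi) / phi * ((1 + lam) / (1 - lam))"
    by (rule less_1_mult)
  then show ?thesis by simp
qed

lemma exponent_ratio_tendsto_0:
  fixes lam :: real
  assumes "0 < lam" "lam < 1"
  shows "(exponent_ratio lam \<longlongrightarrow> 0) (at_right 0)"
proof -
  have num: "((\<lambda>x. ln ((1 - x) / (lam + x))) \<longlongrightarrow> ln ((1 - 0) / (lam + 0))) (at_right 0)"
    using assms by (intro tendsto_intros) auto
  have "filterlim (\<lambda>x::real. (1 - x) / x) at_top (at_right 0)"
  proof (rule LIM_at_top_divide)
    show "((\<lambda>x::real. 1 - x) \<longlongrightarrow> 1 - 0) (at_right 0)"
      by (intro tendsto_intros)
    show "\<forall>\<^sub>F x::real in at_right 0. 0 < x"
      by (rule eventually_at_right_less)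
  qed (auto intro!: tendsto_intros)
  then have "filterlim (\<lambda>x. (1 - x) / x * ((1 + lam) / (1 - lam))) at_top (at_right 0)"
    using assms by (intro filterlim_at_top_mult_tendsto_pos[OF tendsto_const]) auto
  then have "filterlim (\<lambda>x. ln ((1 - x) / x * ((1 + lam) / (1 - lam)))) at_top (at_right 0)"
    by (rule filterlim_compose[OF ln_at_top])
  then have den: "filterlim (\<lambda>x. ln ((1 - x) / x * ((1 + lam) / (1 - lam)))) at_infinity (at_right 0)"
    by (rule filterlim_at_top_imp_at_infinity)
  show ?thesis
    unfolding exponent_ratio_def by (rule tendsto_divide_0[OF num den])
qed

lemma exponent_ratio_attains_max:
  fixes lam :: real
  assumes lam: "0 < lam" "lam < 1"
  shows "\<exists>p\<in>{0<..(1 - lam) / 2}. \<forall>q\<in>{0<..(1 - lam) / 2}.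
           exponent_ratio lam q \<le> exponent_ratio lam p"
proof -
  define a where "a = (1 - lam) / 2"
  define p0 where "p0 = a / 2"
  have a: "0 < a" "0 < p0" "p0 < a" using lam by (auto simp: a_def p0_def)
  have "1 < (1 - p0) / (lam + p0)"
    using lam by (auto simp: a_def p0_def field_simps)
  then have "exponent_ratio lam p0 > 0"
    unfolding exponent_ratio_def
    using exponent_ratio_denominator_pos[of lam p0] a lam
    by (intro divide_pos_pos) (auto simp: a_def)
  then have "\<forall>\<^sub>F x in at_right 0. exponent_ratio lam x < exponent_ratio lam p0"
    by (rule order_tendstoD(2)[OF exponent_ratio_tendsto_0[OF lam]])
  then obtain b where b: "0 < b" "\<And>x. 0 < x \<Longrightarrow> x < b \<Longrightarrow> exponent_ratio lam x < exponent_ratio lam p0"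
    unfolding eventually_at_right_field by blast
  have b_le: "b \<le> p0" using b(2)[of p0] a by force
  have "continuous_on {b..a} (exponent_ratio lam)"
  proof -
    have "ln ((1 - x) / x * ((1 + lam) / (1 - lam))) \<noteq> 0" "x \<noteq> 0" "lam + x \<noteq> 0"
         "1 - x \<noteq> 0" "1 - lam \<noteq> 0" "1 + lam \<noteq> 0"
         "(1 - x) / (lam + x) > 0" "(1 - x) / x * ((1 + lam) / (1 - lam)) > 0"
      if "x \<in> {b..a}" for x
      using that exponent_ratio_denominator_pos[of lam x] lam b(1)
      by (auto simp: a_def intro!: mult_pos_pos divide_pos_pos)
    then show ?thesis
      unfolding exponent_ratio_def
      by (intro continuous_intros) (auto simp: less_imp_neq[symmetric])
  qed
  then obtain p where p: "p \<in> {b..a}" "\<forall>q\<in>{b..a}. exponent_ratio lam q \<le> exponent_ratio lam p"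
    using continuous_attains_sup[of "{b..a}" "exponent_ratio lam"] b_le a by auto
  have "exponent_ratio lam q \<le> exponent_ratio lam p" if "q \<in> {0<..a}" for q
  proof (cases "q < b")
    case True
    then have "exponent_ratio lam q < exponent_ratio lam p0" using b(2) that by auto
    also have "\<dots> \<le> exponent_ratio lam p" using p(2) b_le a by auto
    finally show ?thesis by simp
  qed (use that p(2) in auto)
  moreover have "p \<in> {0<..a}" using p(1) b(1) by auto
  ultimately show ?thesis unfolding a_def by blast
qed

lemma f_hat_is_maximum:
  fixes lam :: real
  assumes "0 < lam" "lam < 1"
  shows "f_hat lam \<in> exponent_ratio lam ` {0<..(1 - lam) / 2}"
    and "\<And>phi. phi \<in> {0<..(1 - lam) / 2} \<Longrightarrow> exponent_ratio lam phi \<le> f_hat lam"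
proof -
  obtain p where p: "p \<in> {0<..(1 - lam) / 2}"
    "\<And>q. q \<in> {0<..(1 - lam) / 2} \<Longrightarrow> exponent_ratio lam q \<le> exponent_ratio lam p"
    using exponent_ratio_attains_max[OF assms] by blast
  have "f_hat lam = exponent_ratio lam p"
    unfolding f_hat_def by (rule Greatest_equality) (use p in auto)
  with p show "f_hat lam \<in> exponent_ratio lam ` {0<..(1 - lam) / 2}"
    and "\<And>phi. phi \<in> {0<..(1 - lam) / 2} \<Longrightarrow> exponent_ratio lam phi \<le> f_hat lam"
    by auto
qed

end

theory Submission
  imports Defs "HOL-Real_Asymp.Real_Asymp"
begin

text \<open>
  Take \<open>\<phi>\<close> attaining the maximum and a rational \<open>r = (J + 2 s) / J\<close> slightly below
  \<open>(1 - \<phi>) / (\<lambda> + \<phi>)\<close>. The graph consists of layers of equally many nodes, with edges between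
  consecutive layers only, so the minority process is the majority process with every other layer
  recolored. A node reacts to the layer above it and ignores the layer below it. Relay layers
  (degree ratio \<open>(1 - \<lambda>) / (1 + \<lambda>)\<close>) copy the layer above; gain layers (degree ratio
  \<open>\<phi> / (1 - \<phi>)\<close>) switch as soon as all but a fraction \<open>s / R\<close> of their inputs disagree, where
  \<open>R = J + 2 s\<close> is the number of kinds of nodes in a layer.

  Let the nodes of a gain layer switch for the \<open>u\<close>-th time in round \<open>u\<close>. An input of kind \<open>k\<close>
  that pauses for two rounds at regular intervals still switches whenever its color is right, and
  if the pauses of the \<open>R\<close> kinds are spread evenly, then each round finds exactly \<open>s\<close> kinds out of
  phase. Thus \<open>J\<close> switches of every input pay for \<open>R\<close> rounds, a gain of \<open>r\<close>. The kinds drift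
  apart by at most two switches, which is what one gain layer and the relay layer fed by it can
  buffer; hence all kinds can be driven by the same layers further up, and \<open>b\<close> pairs of layers
  turn a constant number of switches into about \<open>r ^ b\<close>, while degrees shrink by the factor
  \<open>\<theta> = (1 - \<phi>) / \<phi> * ((1 + \<lambda>) / (1 - \<lambda>))\<close> per pair. The initial constant number comes
  from a chain of layers with all edges in conflict.
\<close>

section \<open>The switching pattern of a relay layer\<close>

locale schedule =
  fixes J s :: nat
  assumes J_pos: "0 < J"
begin

definition R :: nat where "R = J + 2 * s"

lemma R_pos: "0 < R"
  using J_pos by (simp add: R_def)

text \<open>
  The index of the last switch of kind \<open>k\<close> in rounds up to \<open>u\<close>; a node whose index is \<open>m\<close> has the
  color given by the parity of \<open>m\<close>. The quotient counts the pauses so far, and the indicator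
  covers the first round of a pause, where the index stays and is out of phase with \<open>u\<close>.
\<close>

definition idx :: "nat \<Rightarrow> int \<Rightarrow> int" where
  "idx k u = u - 2 * ((int s * u + int k) div int R)
     + (if (int s * u + int k) mod int R < int s then 1 else 0)"

text \<open>A round adds \<open>s\<close> to the residue modulo \<open>R\<close>. If it wraps
  around, the quotient costs 2 and the new indicator returns 1; in the following round that
  indicator lapses. These two rounds form the pause, and every other round adds 1.\<close>

lemma idx_step: "idx k (u + 1) = idx k u \<or> idx k (u + 1) = idx k u + 1"
proof -
  define x where "x = int s * u + int k"
  define q g where "q = x div int R" and "g = x mod int R"
  have x: "x = q * int R + g" and g: "0 \<le> g" "g < int R"
    using R_pos by (auto simp: q_def g_def)
  have Rs: "int R = int J + 2 * int s" "0 < int J" using J_pos by (auto simp: R_def)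
  have x1: "int s * (u + 1) + int k = x + int s" by (simp add: x_def algebra_simps)
  show ?thesis
  proof (cases "g + int s < int R")
    case True
    have "(x + int s) div int R = q" "(x + int s) mod int R = g + int s"
      using True g by (auto simp: x add.assoc intro: int_div_pos_eq int_mod_pos_eq)
    then show ?thesis using g by (auto simp: idx_def x1 x_def[symmetric] q_def[symmetric] g_def[symmetric])
  next
    case False
    have e: "x + int s = (q + 1) * int R + (g + int s - int R)" by (simp add: x algebra_simps)
    have "(x + int s) div int R = q + 1" "(x + int s) mod int R = g + int s - int R"
      using False g Rs unfolding e by (auto intro: int_div_pos_eq int_mod_pos_eq)
    moreover have "int s \<le> g" "g + int s - int R < int s" using False g Rs by linarith+
    ultimately show ?thesis
      by (auto simp: idx_def x1 x_def[symmetric] q_def[symmetric] g_def[symmetric])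
  qed
qed

text \<open>Adding \<open>k < R\<close> wraps around at most once. Without a wrap only the indicator
  can be lost; with a wrap 2 is lost and at most the indicator regained.\<close>

lemma idx_skew:
  assumes "k < R"
  shows "idx 0 u - 2 \<le> idx k u" "idx k u \<le> idx 0 u"
proof -
  define x where "x = int s * u"
  define q g where "q = x div int R" and "g = x mod int R"
  have x: "x = q * int R + g" and g: "0 \<le> g" "g < int R"
    using R_pos by (auto simp: q_def g_def)
  have "idx 0 u - 2 \<le> idx k u \<and> idx k u \<le> idx 0 u"
  proof (cases "g + int k < int R")
    case True
    have "(x + int k) div int R = q" "(x + int k) mod int R = g + int k"
      using True g by (auto simp: x add.assoc intro: int_div_pos_eq int_mod_pos_eq)
    then show ?thesis using g by (auto simp: idx_def x_def[symmetric] q_def[symmetric] g_def[symmetric])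
  next
    case False
    have e: "x + int k = (q + 1) * int R + (g + int k - int R)" by (simp add: x algebra_simps)
    have "(x + int k) div int R = q + 1" "(x + int k) mod int R = g + int k - int R"
      using False g assms unfolding e by (auto intro: int_div_pos_eq int_mod_pos_eq)
    then show ?thesis using g False assms
      by (auto simp: idx_def x_def[symmetric] q_def[symmetric] g_def[symmetric])
  qed
  then show "idx 0 u - 2 \<le> idx k u" "idx k u \<le> idx 0 u" by auto
qed

text \<open>Shifting by \<open>x\<close> permutes the residues, and \<open>R - s = J + s\<close> of
  them are at least \<open>s\<close>.\<close>

lemma card_shifted_residues:
  fixes x :: int
  shows "card {k. k < R \<and> \<not> (x + int k) mod int R < int s} = J + s"
proof -
  have "bij_betw (\<lambda>k. nat ((x + int k) mod int R)) {k. k < R \<and> \<not> (x + int k) mod int R < int s} {s..<R}"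
  proof (rule bij_betw_byWitness[where f' = "\<lambda>y. nat ((int y - x) mod int R)"])
    show "\<forall>k\<in>{k. k < R \<and> \<not> (x + int k) mod int R < int s}.
        nat ((int (nat ((x + int k) mod int R)) - x) mod int R) = k"
      using R_pos by (auto simp: mod_diff_left_eq)
    show "\<forall>y\<in>{s..<R}. nat ((x + int (nat ((int y - x) mod int R))) mod int R) = y"
      using R_pos by (auto simp: mod_add_right_eq)
    show "(\<lambda>k. nat ((x + int k) mod int R)) ` {k. k < R \<and> \<not> (x + int k) mod int R < int s} \<subseteq> {s..<R}"
      using R_pos by (auto simp: nat_less_iff)
    show "(\<lambda>y. nat ((int y - x) mod int R)) ` {s..<R} \<subseteq> {k. k < R \<and> \<not> (x + int k) mod int R < int s}"
      using R_pos by (auto simp: nat_less_iff mod_add_right_eq)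
  qed
  then show ?thesis by (auto dest!: bij_betw_same_card simp: R_def)
qed

lemma card_in_phase: "card {k. k < R \<and> even (idx k u - u)} = J + s"
proof -
  have "{k. k < R \<and> even (idx k u - u)} = {k. k < R \<and> \<not> (int s * u + int k) mod int R < int s}"
    by (auto simp: idx_def)
  then show ?thesis using card_shifted_residues by simp
qed

definition rate :: real where "rate = real R / real J"

lemma rate_ge1: "1 \<le> rate" using J_pos by (simp add: rate_def R_def)

lemma idx_bounds:
  "real_of_int (idx 0 u) \<le> real_of_int u / rate + 3" "real_of_int u / rate \<le> real_of_int (idx 0 u)"
proof -
  define q where "q = (int s * u) div int R"
  have R: "real R > 0" using R_pos by simp
  have "int R * q + (int s * u) mod int R = int s * u" by (simp add: q_def)
  moreover have "0 \<le> (int s * u) mod int R" "(int s * u) mod int R < int R" using R_pos by auto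
  ultimately have "int R * q \<le> int s * u" "int s * u < int R * q + int R" by linarith+
  then have "real_of_int (int R * q) \<le> real_of_int (int s * u)"
      "real_of_int (int s * u) < real_of_int (int R * q + int R)"
    by (simp_all only: of_int_le_iff of_int_less_iff)
  then have a: "real_of_int q \<le> real s * u / real R" "real s * u / real R < q + 1"
    using R by (auto simp: field_simps)
  \<comment> \<open>The factor \<open>1 / rate\<close> is
    \<open>J / R = 1 - 2 * s / R\<close>.\<close>
  have b: "real_of_int u / rate = u - 2 * (real s * u / real R)"
    using R J_pos by (simp add: rate_def field_simps) (simp add: R_def algebra_simps)
  show "real_of_int (idx 0 u) \<le> real_of_int u / rate + 3" "real_of_int u / rate \<le> real_of_int (idx 0 u)"
    using a unfolding b by (auto simp: idx_def q_def[symmetric])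
qed

lemma idx_nonneg: assumes "0 \<le> u" shows "0 \<le> idx 0 u"
proof -
  have "0 \<le> real_of_int u / rate" using assms rate_ge1 by simp
  also note idx_bounds(2)
  finally show ?thesis by simp
qed

lemma idx_mono: assumes "u \<le> v" shows "idx k u \<le> idx k v"
  using assms
proof (induction v rule: int_ge_induct)
  case (step v) then show ?case using idx_step[of k v] by auto
qed simp

section \<open>Token moves on layers of kinds\<close>

text \<open>
  \<open>\<sigma> i k\<close> is the switch index of the nodes of kind \<open>k\<close> in layer \<open>i\<close>, with layer \<open>0\<close> at the
  bottom; even layers are relay layers and odd layers are gain layers.
\<close>

definition enabled :: "(nat \<Rightarrow> nat \<Rightarrow> int) \<Rightarrow> nat \<Rightarrow> nat \<Rightarrow> bool" where
  "enabled \<sigma> i k \<longleftrightarrow> (if even i then odd (\<sigma> (Suc i) k - \<sigma> i k)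
     else J + s \<le> card {j. j < R \<and> odd (\<sigma> (Suc i) j - \<sigma> i k)})"

definition bump :: "(nat \<Rightarrow> nat \<Rightarrow> int) \<Rightarrow> nat \<Rightarrow> nat set \<Rightarrow> nat \<Rightarrow> nat \<Rightarrow> int" where
  "bump \<sigma> i K = \<sigma>(i := \<lambda>k. if k \<in> K then \<sigma> i k + 1 else \<sigma> i k)"

inductive reach :: "nat \<Rightarrow> (nat \<Rightarrow> nat \<Rightarrow> int) \<Rightarrow> (nat \<Rightarrow> nat \<Rightarrow> int) \<Rightarrow> bool" for H \<sigma> where
  refl: "reach H \<sigma> \<sigma>"
| step: "reach H \<sigma> \<tau> \<Longrightarrow> i < H \<Longrightarrow> k < R \<Longrightarrow> enabled \<tau> i k \<Longrightarrow> reach H \<sigma> (bump \<tau> i {k})"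

lemma reach_trans: "reach H \<tau> \<upsilon> \<Longrightarrow> reach H \<sigma> \<tau> \<Longrightarrow> reach H \<sigma> \<upsilon>"
  by (induction rule: reach.induct) (auto intro: reach.step)

text \<open>At layer \<open>i\<close>, \<open>enabled\<close> looks only at layer
  \<open>i + 1\<close> and at the moving kind itself, so the members of \<open>K\<close> can move
  one after another.\<close>

lemma reach_bump:
  assumes "K \<subseteq> {..<R}" "i < H" "\<And>k. k \<in> K \<Longrightarrow> enabled \<sigma> i k"
  shows "reach H \<sigma> (bump \<sigma> i K)"
proof -
  have "finite K" using assms(1) finite_subset by blast
  then show ?thesis using assms(1,3)
  proof (induction K)
    case empty
    have "bump \<sigma> i {} = \<sigma>" by (auto simp: bump_def)
    then show ?case by (simp add: reach.refl)
  next
    case (insert k K)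
    have "reach H \<sigma> (bump \<sigma> i K)" using insert by auto
    moreover have "enabled (bump \<sigma> i K) i k"
      using insert.prems(2)[of k] insert.hyps by (auto simp: enabled_def bump_def)
    ultimately have "reach H \<sigma> (bump (bump \<sigma> i K) i {k})"
      using insert.prems assms(2) by (auto intro!: reach.step)
    moreover have "bump (bump \<sigma> i K) i {k} = bump \<sigma> i (insert k K)"
      using insert.hyps by (auto simp: bump_def fun_eq_iff)
    ultimately show ?case by simp
  qed
qed

text \<open>Shifting by two layers, not one, preserves the alternation of relay and gain layers.\<close>

definition stack :: "(nat \<Rightarrow> int) \<Rightarrow> (nat \<Rightarrow> int) \<Rightarrow> (nat \<Rightarrow> nat \<Rightarrow> int) \<Rightarrow> nat \<Rightarrow> nat \<Rightarrow> int" where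
  "stack a d \<tau> i = (if i = 0 then a else if i = 1 then d else \<tau> (i - 2))"

lemma stack_simps [simp]:
  "stack a d \<tau> 0 = a" "stack a d \<tau> (Suc 0) = d" "stack a d \<tau> (Suc (Suc i)) = \<tau> i"
  by (simp_all add: stack_def)

lemma bump_stack:
  "bump (stack a d \<tau>) 0 K = stack (\<lambda>k. if k \<in> K then a k + 1 else a k) d \<tau>"
  "bump (stack a d \<tau>) (Suc 0) K = stack a (\<lambda>k. if k \<in> K then d k + 1 else d k) \<tau>"
  "bump (stack a d \<tau>) (Suc (Suc i)) K = stack a d (bump \<tau> i K)"
  by (auto simp: bump_def stack_def fun_eq_iff)

lemma reach_stack:
  assumes "reach H \<tau> \<upsilon>" shows "reach (Suc (Suc H)) (stack a d \<tau>) (stack a d \<upsilon>)"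
  using assms
proof induction
  case (step \<upsilon> i k)
  have "enabled (stack a d \<upsilon>) (Suc (Suc i)) k" using step.hyps(4) by (cases "even i") (simp_all add: enabled_def)
  then show ?case using reach.step[OF step.IH, of "Suc (Suc i)" k] step by (simp add: bump_stack)
qed (rule reach.refl)

lemma reach_layer0:
  assumes "0 < H" "\<And>k. a' k \<noteq> a k \<Longrightarrow> k < R \<and> a' k = a k + 1 \<and> odd (d k - a k)"
  shows "reach H (stack a d \<tau>) (stack a' d \<tau>)"
proof -
  have "reach H (stack a d \<tau>) (bump (stack a d \<tau>) 0 {k. a' k \<noteq> a k})"
    using assms by (intro reach_bump) (auto simp: enabled_def)
  also have "bump (stack a d \<tau>) 0 {k. a' k \<noteq> a k} = stack a' d \<tau>"
    unfolding bump_stack using assms(2) by (intro arg_cong[where f="\<lambda>a. stack a d \<tau>"]) force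
  finally show ?thesis .
qed

text \<open>Here \<open>m\<close> is the round of the inputs: enough kinds above agree with it in
  parity that any gain node out of phase with \<open>m\<close> may move.\<close>

lemma reach_layer1:
  assumes "1 < H" "\<And>k. d' k \<noteq> d k \<Longrightarrow> k < R \<and> d' k = d k + 1 \<and> odd (m - d k)"
    and phase: "J + s \<le> card {j. j < R \<and> even (\<tau> 0 j - m)}"
  shows "reach H (stack a d \<tau>) (stack a d' \<tau>)"
proof -
  have "enabled (stack a d \<tau>) (Suc 0) k" if "d' k \<noteq> d k" for k
  proof -
    have "{j. j < R \<and> even (\<tau> 0 j - m)} = {j. j < R \<and> odd (\<tau> 0 j - d k)}"
      using assms(2)[OF that] by auto
    then show ?thesis using phase by (simp add: enabled_def)
  qed
  then have "reach H (stack a d \<tau>) (bump (stack a d \<tau>) (Suc 0) {k. d' k \<noteq> d k})"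
    using assms by (intro reach_bump) auto
  also have "bump (stack a d \<tau>) (Suc 0) {k. d' k \<noteq> d k} = stack a d' \<tau>"
    unfolding bump_stack using assms(2) by (intro arg_cong[where f="\<lambda>d. stack a d \<tau>"]) force
  finally show ?thesis .
qed

text \<open>The default 0 beyond the actual kinds lets configurations be compared as
  functions.\<close>

definition relay :: "int \<Rightarrow> nat \<Rightarrow> int" where
  "relay u k = (if k < R then idx k u else 0)"

text \<open>
  A gain node switches as early as possible: it must not overtake the round \<open>idx 0 u\<close> of its own
  inputs, nor run more than one switch ahead of the relay node that copies it.
\<close>

definition gain :: "int \<Rightarrow> nat \<Rightarrow> int" where
  "gain u k = (if k < R then min (idx 0 u) (idx k u + 1) else 0)"

text \<open>
  In the chain on top, layer \<open>i\<close> is one switch ahead of the layer below it until it reaches its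
  final index \<open>Q\<close>.
\<close>

fun canon :: "nat \<Rightarrow> nat \<Rightarrow> int \<Rightarrow> nat \<Rightarrow> nat \<Rightarrow> int" where
  "canon Q 0 u = (\<lambda>i k. if k < R then min (int Q) (u + int i) else 0)"
| "canon Q (Suc b) u = stack (relay u) (gain u) (canon Q b (idx 0 u))"

text \<open>The round of the chain on top when the bottom is in round \<open>u\<close>; each pair of
  layers slows down everything above it.\<close>

fun top :: "nat \<Rightarrow> int \<Rightarrow> int" where
  "top 0 u = u"
| "top (Suc b) u = top b (idx 0 u)"

section \<open>Reachability of the configuration of each round\<close>

lemma top_mono: "u \<le> v \<Longrightarrow> top b u \<le> top b v"
  by (induction b arbitrary: u v) (auto intro: idx_mono)

lemma canon_phase:
  assumes "top b u \<le> int Q"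
  shows "J + s \<le> card {j. j < R \<and> even (canon Q b u 0 j - u)}"
proof (cases b)
  case 0
  then have "{j. j < R \<and> even (canon Q b u 0 j - u)} = {..<R}" using assms by auto
  then show ?thesis by (simp add: R_def)
next
  case (Suc b')
  have "{j. j < R \<and> even (canon Q b u 0 j - u)} = {j. j < R \<and> even (idx j u - u)}"
    by (auto simp: Suc relay_def)
  then show ?thesis using card_in_phase by simp
qed

text \<open>Layers move from the bottom up, so layer \<open>n + 1\<close> is still one switch ahead
  when layer \<open>n\<close> moves. Layers at index \<open>Q\<close> rest, in particular all layers
  from \<open>Q\<close> on, as \<open>u\<close> is nonnegative.\<close>

lemma reach_canon_0:
  assumes "0 \<le> u" "u + 1 \<le> int Q"
  shows "reach Q (canon Q 0 u) (canon Q 0 (u + 1))"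
proof -
  define \<sigma> where "\<sigma> n = (\<lambda>i. canon Q 0 (if i < n then u + 1 else u) i)" for n :: nat
  have "reach Q (\<sigma> 0) (\<sigma> n)" if "n \<le> Q" for n
    using that
  proof (induction n)
    case (Suc n)
    define K where "K = (if u + int n < int Q then {..<R} else {})"
    have "reach Q (\<sigma> n) (bump (\<sigma> n) n K)"
    proof (rule reach_bump)
      fix k assume k: "k \<in> K"
      have un: "u + int n < int Q" using k by (auto simp: K_def split: if_splits)
      have "{j. j < R \<and> odd (\<sigma> n (Suc n) j - \<sigma> n n k)} = {..<R}" if "odd n"
        using k un by (auto simp: \<sigma>_def K_def)
      then show "enabled (\<sigma> n) n k"
        using k un by (auto simp: enabled_def R_def) (auto simp: \<sigma>_def K_def)
    qed (use Suc in \<open>auto simp: K_def\<close>)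
    also have "bump (\<sigma> n) n K = \<sigma> (Suc n)"
      by (auto simp: fun_eq_iff bump_def \<sigma>_def K_def)
    finally show ?case using Suc by (auto intro: reach_trans)
  qed (rule reach.refl)
  from this[of Q] have "reach Q (\<sigma> 0) (\<sigma> Q)" by simp
  moreover have "\<sigma> 0 = canon Q 0 u" by (simp add: \<sigma>_def)
  moreover have "\<sigma> Q = canon Q 0 (u + 1)" using assms by (auto simp: \<sigma>_def fun_eq_iff)
  ultimately show ?thesis by simp
qed

text \<open>Relay nodes behind the round \<open>M\<close> of the gain nodes' inputs move first. This
  frees their gain nodes, which catch up with \<open>M\<close> while the layers above are still in
  that round. Then the layers above pass to \<open>M'\<close>, and the gain nodes and finally the
  remaining relay nodes follow.\<close>

lemma reach_canon:
  assumes "0 \<le> u" "top b (u + 1) \<le> int Q"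
  shows "reach (2 * b + Q) (canon Q b u) (canon Q b (u + 1))"
  using assms
proof (induction b arbitrary: u)
  case 0
  then show ?case using reach_canon_0[of u Q] by simp
next
  case (Suc b)
  define M M' where "M = idx 0 u" and "M' = idx 0 (u + 1)"
  define \<tau> where "\<tau> = canon Q b"
  define H where "H = 2 * b + Q"
  have H2: "0 < Suc (Suc H)" "1 < Suc (Suc H)" by simp_all
  have M': "M' = M \<or> M' = M + 1" using idx_step[of 0 u] by (auto simp: M_def M'_def)
  have topM: "top b M' \<le> int Q" using Suc.prems by (simp add: M'_def)
  moreover have "top b M \<le> top b M'" using M' by (auto intro: top_mono)
  ultimately have topM0: "top b M \<le> int Q" by simp
  note ph = canon_phase[OF topM0, folded \<tau>_def] and ph' = canon_phase[OF topM, folded \<tau>_def]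
  have lo: "M - 2 \<le> idx k u" "idx k u \<le> M" and lo': "M' - 2 \<le> idx k (u+1)" "idx k (u+1) \<le> M'"
    if "k < R" for k using idx_skew[OF that] by (auto simp: M_def M'_def)
  define a1 where "a1 k = (if idx k u < M then relay (u + 1) k else relay u k)" for k
  have s1: "reach (Suc (Suc H)) (stack (relay u) (gain u) (\<tau> M)) (stack a1 (gain u) (\<tau> M))"
  proof (rule reach_layer0[OF H2(1)])
    fix k assume k: "a1 k \<noteq> relay u k"
    then have "k < R" "idx k u < M" by (auto simp: a1_def relay_def split: if_splits)
    moreover from this have "gain u k = idx k u + 1" by (simp add: gain_def M_def[symmetric])
    ultimately show "k < R \<and> a1 k = relay u k + 1 \<and> odd (gain u k - relay u k)"
      using k idx_step[of k u] by (auto simp: a1_def relay_def)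
  qed
  define d1 where "d1 k = (if k < R then min M (idx k (u + 1) + 1) else 0)" for k
  have s2: "reach (Suc (Suc H)) (stack a1 (gain u) (\<tau> M)) (stack a1 d1 (\<tau> M))"
  proof (rule reach_layer1[where m = M and \<tau> = "\<tau> M", OF H2(2) _ ph])
    fix k assume k: "d1 k \<noteq> gain u k"
    then have kR: "k < R" by (auto simp: d1_def gain_def split: if_splits)
    \<comment> \<open>A gain node moves here only if \<open>idx k u + 1 < M\<close>. The skew bound
      then forces \<open>idx k u = M - 2\<close>, so a single switch takes it from
      \<open>M - 1\<close> to \<open>M\<close>.\<close>
    have "d1 k = gain u k + 1 \<and> M = gain u k + 1"
      using k idx_step[of k u] lo[OF kR] lo'[OF kR] M' kR
      by (auto simp: d1_def gain_def M_def[symmetric] min_def split: if_splits)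
    then show "k < R \<and> d1 k = gain u k + 1 \<and> odd (M - gain u k)"
      using kR by simp
  qed
  have s3: "reach (Suc (Suc H)) (stack a1 d1 (\<tau> M)) (stack a1 d1 (\<tau> M'))"
  proof (rule reach_stack, cases "M' = M")
    case True
    then show "reach H (\<tau> M) (\<tau> M')" by (simp add: reach.refl)
  next
    case False
    then have "M' = M + 1" using M' by simp
    moreover have "0 \<le> M" using idx_nonneg[OF Suc.prems(1)] by (simp add: M_def)
    ultimately show "reach H (\<tau> M) (\<tau> M')"
      using Suc.IH[of M] topM by (simp add: \<tau>_def H_def)
  qed
  have s4: "reach (Suc (Suc H)) (stack a1 d1 (\<tau> M')) (stack a1 (gain (u + 1)) (\<tau> M'))"
  proof (rule reach_layer1[where m = M' and \<tau> = "\<tau> M'", OF H2(2) _ ph'])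
    fix k assume k: "gain (u + 1) k \<noteq> d1 k"
    then have kR: "k < R" by (auto simp: d1_def gain_def split: if_splits)
    have "gain (u + 1) k = d1 k + 1 \<and> M' = d1 k + 1"
      using k M' kR lo'[OF kR]
      by (auto simp: d1_def gain_def M'_def[symmetric] min_def split: if_splits)
    then show "k < R \<and> gain (u + 1) k = d1 k + 1 \<and> odd (M' - d1 k)"
      using kR by simp
  qed
  have s5: "reach (Suc (Suc H)) (stack a1 (gain (u + 1)) (\<tau> M'))
              (stack (relay (u + 1)) (gain (u + 1)) (\<tau> M'))"
  proof (rule reach_layer0[OF H2(1)])
    fix k assume k: "relay (u + 1) k \<noteq> a1 k"
    then have kR: "k < R" "\<not> idx k u < M" by (auto simp: a1_def relay_def split: if_splits)
    \<comment> \<open>These nodes have \<open>idx k u = M\<close>; they move only if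
      \<open>M' = M + 1\<close>, and then their gain nodes are already at \<open>M'\<close>.\<close>
    show "k < R \<and> relay (u + 1) k = a1 k + 1 \<and> odd (gain (u + 1) k - a1 k)"
      using k kR idx_step[of k u] lo[OF kR(1)] lo'[OF kR(1)] M'
      by (auto simp: a1_def relay_def gain_def M'_def[symmetric] min_def)
  qed
  have "reach (Suc (Suc H)) (canon Q (Suc b) u) (canon Q (Suc b) (u + 1))"
    using reach_trans[OF s5 reach_trans[OF s4 reach_trans[OF s3 reach_trans[OF s2 s1]]]]
    by (simp add: \<tau>_def M_def M'_def)
  then show ?case by (simp add: H_def)
qed

lemma reach_canon_rounds:
  assumes "top b (int U) \<le> int Q"
  shows "reach (2 * b + Q) (canon Q b 0) (canon Q b (int U))"
  using assms
proof (induction U)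
  case (Suc U)
  have e: "int (Suc U) = int U + 1" by simp
  have "top b (int U) \<le> top b (int (Suc U))" by (rule top_mono) simp
  then have "reach (2 * b + Q) (canon Q b 0) (canon Q b (int U))" using Suc by simp
  moreover have "reach (2 * b + Q) (canon Q b (int U)) (canon Q b (int (Suc U)))"
    using Suc.prems unfolding e by (intro reach_canon) auto
  ultimately show ?case by (rule reach_trans[rotated])
qed (simp add: reach.refl)

lemma top_bound:
  assumes "1 < rate"
  shows "real_of_int (top b u) \<le> real_of_int u / rate ^ b + 3 * rate / (rate - 1)"
proof -
  \<comment> \<open>The last factor turns the constant into the geometric sum of
    \<open>3 / rate ^ i\<close> over \<open>i < b\<close>; the bare constant would not be
    inductive.\<close>
  have "real_of_int (top b u) \<le> real_of_int u / rate ^ b + 3 * rate / (rate - 1) * (1 - 1 / rate ^ b)"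
  proof (induction b arbitrary: u)
    case (Suc b)
    have "real_of_int (top (Suc b) u) \<le> real_of_int (idx 0 u) / rate ^ b
        + 3 * rate / (rate - 1) * (1 - 1 / rate ^ b)" using Suc by simp
    also have "\<dots> \<le> (real_of_int u / rate + 3) / rate ^ b + 3 * rate / (rate - 1) * (1 - 1 / rate ^ b)"
      using idx_bounds(1)[of u] assms by (intro add_right_mono divide_right_mono) auto
    also have "\<dots> = real_of_int u / rate ^ Suc b + 3 * rate / (rate - 1) * (1 - 1 / rate ^ Suc b)"
    proof -
      define p where "p = rate ^ b"
      have "p \<noteq> 0" using assms by (simp add: p_def)
      then show ?thesis using assms unfolding power_Suc p_def[symmetric] by (simp add: divide_simps) algebra
    qed
    finally show ?case .
  qed simp
  also have "\<dots> \<le> real_of_int u / rate ^ b + 3 * rate / (rate - 1) * 1"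
    using assms by (intro add_left_mono mult_left_mono) auto
  finally show ?thesis by simp
qed

end

section \<open>Independent switches\<close>

lemma switchable_cong:
  assumes "c v = c' v" "\<And>u. u \<in> neighbors E v \<Longrightarrow> c u = c' u"
  shows "switchable P lam E c v \<longleftrightarrow> switchable P lam E c' v"
proof -
  have "conflict_neighbors P E c v = conflict_neighbors P E c' v"
    using assms by (cases P) (auto simp: conflict_neighbors_def)
  then show ?thesis by (simp add: switchable_def)
qed

lemma valid_switches_append:
  "valid_switches P lam V E c (xs @ ys) \<longleftrightarrow>
     valid_switches P lam V E c xs \<and> valid_switches P lam V E (foldl switch c xs) ys"
  by (induction xs arbitrary: c) auto

text \<open>Switching one node of an independent set changes no neighbor of the others, so all
  conditions can be checked in \<open>c\<close>.\<close>

lemma valid_switches_independent: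
  assumes "distinct vs" "set vs \<subseteq> V" "\<And>v. v \<in> set vs \<Longrightarrow> switchable P lam E c v"
    and "\<And>u v. u \<in> set vs \<Longrightarrow> v \<in> set vs \<Longrightarrow> {u, v} \<notin> E"
  shows "valid_switches P lam V E c vs \<and>
    foldl switch c vs = (\<lambda>v. if v \<in> set vs then opposite (c v) else c v)"
  using assms
proof (induction vs arbitrary: c)
  case (Cons v vs)
  have "switchable P lam E (switch c v) w" if "w \<in> set vs" for w
  proof -
    have "switchable P lam E (switch c v) w \<longleftrightarrow> switchable P lam E c w"
      using that Cons.prems(1,4) by (intro switchable_cong) (auto simp: switch_def neighbors_def)
    then show ?thesis using that Cons.prems(3) by simp
  qed
  then have "valid_switches P lam V E (switch c v) vs \<and> foldl switch (switch c v) vs =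
      (\<lambda>w. if w \<in> set vs then opposite (switch c v w) else switch c v w)"
    using Cons.prems by (intro Cons.IH) auto
  moreover have "(\<lambda>w. if w \<in> set vs then opposite (switch c v w) else switch c v w) =
      (\<lambda>w. if w \<in> set (v # vs) then opposite (c w) else c w)"
    using Cons.prems(1) by (auto simp: switch_def fun_eq_iff)
  ultimately show ?case using Cons.prems by simp
qed simp

section \<open>Counting on a cycle of length \<open>W\<close>\<close>

lemma cyclic_diff:
  fixes x y W :: nat
  assumes "x < W" "y < W"
  shows "(y + W - x) mod W = (if x \<le> y then y - x else y + W - x)"
proof (cases "x \<le> y")
  case True
  then have "y + W - x = (y - x) + W" by simp
  then show ?thesis using True assms by (simp only: mod_add_self2) simp
qed (use assms in simp)

lemma card_window_right:
  fixes x c W :: nat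
  assumes "x < W" "c \<le> W"
  shows "card {y. y < W \<and> (y + W - x) mod W < c} = c"
proof -
  have "bij_betw (\<lambda>y. (y + W - x) mod W) {y. y < W \<and> (y + W - x) mod W < c} {..<c}"
    by (rule bij_betw_byWitness[where f' = "\<lambda>d. if d + x < W then d + x else d + x - W"])
      (use assms in \<open>auto simp: cyclic_diff\<close>)
  then show ?thesis by (auto dest: bij_betw_same_card)
qed

lemma card_window_left:
  fixes x c W :: nat
  assumes "x < W" "c \<le> W"
  shows "card {y. y < W \<and> (x + W - y) mod W < c} = c"
proof -
  have "bij_betw (\<lambda>y. (x + W - y) mod W) {y. y < W \<and> (x + W - y) mod W < c} {..<c}"
    by (rule bij_betw_byWitness[where f' = "\<lambda>d. if d \<le> x then x - d else x + W - d"])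
      (use assms in \<open>auto simp: cyclic_diff\<close>)
  then show ?thesis by (auto dest: bij_betw_same_card)
qed

lemma card_pairs_single:
  fixes W R k :: nat
  assumes "k < R"
  shows "card {(y, j). y < W \<and> j < R \<and> (j = k \<and> A y \<and> Q j)} =
    (if Q k then card {y. y < W \<and> A y} else 0)"
proof -
  have "{(y, j). y < W \<and> j < R \<and> (j = k \<and> A y \<and> Q j)} =
      {y. y < W \<and> A y} \<times> (if Q k then {k} else {})"
    using assms by auto
  then show ?thesis by (simp add: card_cartesian_product)
qed

lemma card_pairs_product:
  fixes W R :: nat
  shows "card {(y, j). y < W \<and> j < R \<and> (A y \<and> Q j)} =
    card {y. y < W \<and> A y} * card {j. j < R \<and> Q j}"
proof -
  have "{(y, j). y < W \<and> j < R \<and> (A y \<and> Q j)} = {y. y < W \<and> A y} \<times> {j. j < R \<and> Q j}"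
    by auto
  then show ?thesis by (simp add: card_cartesian_product)
qed

section \<open>The layered graph\<close>

text \<open>Each node of layer \<open>i < H\<close> gets \<open>R * z i\<close> edges up, and each
  node of layer \<open>i + 1\<close> as many down; \<open>z_le\<close> lets the windows fit around
  the cycle. By \<open>z_relay\<close> all upper neighbors of a relay node, and by
  \<open>z_gain\<close> those of \<open>J + s\<close> kinds for a gain node, reach the switching
  threshold.\<close>

locale layered_graph = schedule +
  fixes lam :: real and P :: process and W H :: nat and z :: "nat \<Rightarrow> nat"
  assumes lam: "0 < lam" "lam < 1"
    and H_pos: "0 < H"
    and z_pos: "\<And>i. i < H \<Longrightarrow> 0 < z i"
    and z_le: "\<And>i. i < H \<Longrightarrow> R * z i \<le> W"
    and z_relay: "\<And>i. even (Suc i) \<Longrightarrow> (1 + lam) * (real (z (Suc i)) + real (z i)) \<le> 2 * real (z (Suc i))"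
    and z_gain: "\<And>i. odd (Suc i) \<Longrightarrow> (1 + lam) * real R * (real (z (Suc i)) + real (z i)) \<le> 2 * real (J + s) * real (z (Suc i))"
begin

lemma W_pos: "0 < W"
proof -
  have "0 < R * z 0" using R_pos z_pos[of 0] H_pos by simp
  then show ?thesis using z_le[of 0] H_pos by linarith
qed

definition node :: "nat \<Rightarrow> nat \<Rightarrow> nat \<Rightarrow> nat" where
  "node i x k = (i * W + x) * R + k"

definition layer :: "nat \<Rightarrow> nat" where "layer v = v div R div W"
definition place :: "nat \<Rightarrow> nat" where "place v = v div R mod W"
definition kind :: "nat \<Rightarrow> nat" where "kind v = v mod R"

lemma node_sel [simp]:
  assumes "x < W" "k < R"
  shows "layer (node i x k) = i" "place (node i x k) = x" "kind (node i x k) = k"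
  using assms by (auto simp: node_def layer_def place_def kind_def)

lemma node_eta [simp]: "node (layer v) (place v) (kind v) = v"
  by (simp only: node_def layer_def place_def kind_def div_mult_mod_eq)

lemma place_less: "place v < W" and kind_less: "kind v < R"
  using W_pos R_pos by (auto simp: place_def kind_def)

definition V :: "nat set" where "V = {..<(H + 1) * W * R}"

lemma in_V_iff: "v \<in> V \<longleftrightarrow> layer v \<le> H"
proof -
  have "layer v \<le> H \<longleftrightarrow> v div R div W < H + 1" by (auto simp: layer_def)
  also have "\<dots> \<longleftrightarrow> v < (H + 1) * W * R"
    using W_pos R_pos by (simp only: div_less_iff_less_mult)
  finally show ?thesis by (simp add: V_def)
qed

text \<open>A relay node sees \<open>R * z\<close> nodes of its own kind, a gain node
  \<open>z\<close> nodes of each kind, so both have equally many upper neighbors. Cyclic windows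
  keep degrees uniform within a layer.\<close>

definition adj :: "nat \<Rightarrow> nat \<Rightarrow> bool" where
  "adj v u \<longleftrightarrow> layer u = Suc (layer v) \<and>
     (if even (layer v) then kind u = kind v \<and> (place u + W - place v) mod W < R * z (layer v)
      else (place u + W - place v) mod W < z (layer v))"

lemma adj_layer: "adj v u \<Longrightarrow> layer u = Suc (layer v)"
  by (simp add: adj_def)

definition E :: "nat set set" where
  "E = {{v, u} | v u. v \<in> V \<and> u \<in> V \<and> adj v u}"

definition up :: "nat \<Rightarrow> nat set" where "up v = {u \<in> V. adj v u}"
definition down :: "nat \<Rightarrow> nat set" where "down v = {u \<in> V. adj u v}"

lemma simple_graph_E: "simple_graph V E"
proof -
  have "finite V" by (simp add: V_def)
  moreover have "v \<noteq> u" if "adj v u" for v u using adj_layer[OF that] by auto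
  ultimately show ?thesis unfolding simple_graph_def E_def by blast
qed

lemma neighbors_E: "v \<in> V \<Longrightarrow> neighbors E v = up v \<union> down v"
  by (auto simp: neighbors_def E_def up_def down_def doubleton_eq_iff)

section \<open>Degrees\<close>

lemma card_layer:
  assumes "i \<le> H"
  shows "card {u \<in> V. layer u = i \<and> Q (place u) (kind u)} = card {(y, j). y < W \<and> j < R \<and> Q y j}"
proof -
  have "bij_betw (\<lambda>u. (place u, kind u)) {u \<in> V. layer u = i \<and> Q (place u) (kind u)}
     {(y, j). y < W \<and> j < R \<and> Q y j}"
    by (rule bij_betw_byWitness[where f' = "\<lambda>(y, j). node i y j"])
      (use assms in \<open>auto simp: in_V_iff place_less kind_less\<close>)
  then show ?thesis by (rule bij_betw_same_card)
qed

lemma card_up: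
  assumes "layer v < H"
  shows "card (up v) = R * z (layer v)"
    and "card {u \<in> up v. Q (kind u)} =
      (if even (layer v) then if Q (kind v) then R * z (layer v) else 0
       else z (layer v) * card {j. j < R \<and> Q j})"
proof -
  let ?i = "layer v"
  have i: "Suc ?i \<le> H" using assms by simp
  have zW: "R * z ?i \<le> W" "z ?i \<le> W" using z_le[OF assms] R_pos by (auto intro: order_trans[rotated])
  have *: "card {u \<in> up v. Q (kind u)} =
      (if even ?i then if Q (kind v) then R * z ?i else 0 else z ?i * card {j. j < R \<and> Q j})" for Q
  proof (cases "even ?i")
    case True
    have "{u \<in> up v. Q (kind u)} = {u \<in> V. layer u = Suc ?i \<and>
       (kind u = kind v \<and> (place u + W - place v) mod W < R * z ?i \<and> Q (kind u))}"
      using True unfolding up_def adj_def by auto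
    then show ?thesis
      using True card_window_right[OF place_less zW(1)]
        card_layer[OF i, where Q = "\<lambda>y j. j = kind v \<and> (y + W - place v) mod W < R * z ?i \<and> Q j"]
        card_pairs_single[OF kind_less, where A = "\<lambda>y. (y + W - place v) mod W < R * z ?i"]
      by (simp only: if_True)
  next
    case False
    have "{u \<in> up v. Q (kind u)} = {u \<in> V. layer u = Suc ?i \<and>
       ((place u + W - place v) mod W < z ?i \<and> Q (kind u))}"
      using False unfolding up_def adj_def by auto
    then show ?thesis
      using False card_window_right[OF place_less zW(2)]
        card_layer[OF i, where Q = "\<lambda>y j. (y + W - place v) mod W < z ?i \<and> Q j"]
        card_pairs_product[where A = "\<lambda>y. (y + W - place v) mod W < z ?i"]
      by (simp only: if_False)
  qed
  show "card {u \<in> up v. Q (kind u)} =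
      (if even ?i then if Q (kind v) then R * z ?i else 0 else z ?i * card {j. j < R \<and> Q j})"
    by (rule *)
  show "card (up v) = R * z ?i" using *[of "\<lambda>_. True"] by (simp add: mult.commute split: if_splits)
qed

lemma card_down:
  assumes "layer v = Suc i" "i < H"
  shows "card (down v) = R * z i"
proof -
  have i: "i \<le> H" using assms by simp
  have zW: "R * z i \<le> W" "z i \<le> W" using z_le[OF assms(2)] R_pos by (auto intro: order_trans[rotated])
  show ?thesis
  proof (cases "even i")
    case True
    \<comment> \<open>The conjunct \<open>True\<close> gives the set the shape of
      \<open>card_pairs_single\<close>.\<close>
    have "down v = {u \<in> V. layer u = i \<and> (kind u = kind v \<and> (place v + W - place u) mod W < R * z i \<and> True)}"
      using True assms unfolding down_def adj_def by auto
    then show ?thesis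
      using card_window_left[OF place_less zW(1)]
        card_layer[OF i, where Q = "\<lambda>y j. j = kind v \<and> (place v + W - y) mod W < R * z i \<and> True"]
        card_pairs_single[OF kind_less, where A = "\<lambda>y. (place v + W - y) mod W < R * z i"
          and Q = "\<lambda>_. True"]
      by (simp only: if_True)
  next
    case False
    have "down v = {u \<in> V. layer u = i \<and> ((place v + W - place u) mod W < z i \<and> True)}"
      using False assms unfolding down_def adj_def by auto
    moreover have "card {j. j < R \<and> True} = R" by simp
    ultimately show ?thesis
      using card_window_left[OF place_less zW(2)]
        card_layer[OF i, where Q = "\<lambda>y j. (place v + W - y) mod W < z i \<and> True"]
        card_pairs_product[where A = "\<lambda>y. (place v + W - y) mod W < z i" and Q = "\<lambda>_. True"]
      by (simp only: mult.commute)
  qed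
qed

lemma finite_up: "finite (up v)" and finite_down: "finite (down v)"
  by (auto simp: up_def down_def V_def)

lemma degree_E:
  assumes "v \<in> V"
  shows "degree E v = (if layer v < H then R * z (layer v) else 0)
     + (if 0 < layer v then R * z (layer v - 1) else 0)"
proof -
  have "up v \<inter> down v = {}" by (auto simp: up_def down_def dest!: adj_layer)
  then have "degree E v = card (up v) + card (down v)"
    using assms finite_up finite_down by (simp add: degree_def neighbors_E card_Un_disjoint)
  moreover have "up v = {}" if "\<not> layer v < H" using that by (auto simp: up_def in_V_iff dest: adj_layer)
  moreover have "down v = {}" if "layer v = 0" using that by (auto simp: down_def dest: adj_layer)
  moreover have "card (down v) = R * z (layer v - 1)" if "0 < layer v"
    using that assms by (intro card_down) (auto simp: in_V_iff)
  ultimately show ?thesis using card_up(1)[of v] by auto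
qed

lemma degree_pos: "v \<in> V \<Longrightarrow> 0 < degree E v"
  using H_pos R_pos z_pos[of "layer v"] z_pos[of "layer v - 1"]
  by (auto simp: degree_E in_V_iff)

section \<open>Colorings, and switches from token moves\<close>

definition paint :: "int \<Rightarrow> color" where
  "paint m = (if even m then Black else White)"

definition coloring :: "(nat \<Rightarrow> nat \<Rightarrow> int) \<Rightarrow> nat \<Rightarrow> color" where
  "coloring \<sigma> v = paint (\<sigma> (layer v) (kind v) + (if P = Minority then int (layer v) else 0))"

text \<open>Under \<open>Minority\<close> the added layer number shifts the relative parity of
  consecutive layers by one, which exchanges equal and different colors.\<close>

lemma conflict_adj:
  assumes "layer u = Suc (layer v)"
  shows "conflict P (coloring \<sigma>) u v \<longleftrightarrow> odd (\<sigma> (layer u) (kind u) - \<sigma> (layer v) (kind v))"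
proof (cases P)
  case Majority
  show ?thesis unfolding coloring_def paint_def by (simp add: Majority assms)
next
  case Minority
  show ?thesis unfolding coloring_def paint_def by (simp add: Minority assms)
qed

text \<open>Only conflicts with the layer above are counted; the layer below enters through the
  degree alone and may have any colors.\<close>

lemma enabled_switchable:
  assumes "layer v < H" "enabled \<sigma> (layer v) (kind v)"
  shows "switchable P lam E (coloring \<sigma>) v"
proof -
  define i where "i = layer v"
  define D where "D = (if 0 < i then z (i - 1) else 0)"
  have v: "v \<in> V" using assms by (simp add: in_V_iff)
  have deg: "degree E v = R * z i + R * D"
    using assms v by (simp add: degree_E i_def D_def)
  have "card {u \<in> up v. odd (\<sigma> (Suc i) (kind u) - \<sigma> i (kind v))} \<le> card (conflict_neighbors P E (coloring \<sigma>) v)"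
  proof (rule card_mono)
    show "finite (conflict_neighbors P E (coloring \<sigma>) v)"
      using v finite_up finite_down by (simp add: conflict_neighbors_def neighbors_E)
    show "{u \<in> up v. odd (\<sigma> (Suc i) (kind u) - \<sigma> i (kind v))} \<subseteq> conflict_neighbors P E (coloring \<sigma>) v"
      using v by (auto simp: conflict_neighbors_def neighbors_E up_def i_def conflict_adj adj_layer)
  qed
  moreover have "(1 + lam) / 2 * real (degree E v) \<le>
      real (card {u \<in> up v. odd (\<sigma> (Suc i) (kind u) - \<sigma> i (kind v))})"
  proof (cases "even i")
    case True
    then have "card {u \<in> up v. odd (\<sigma> (Suc i) (kind u) - \<sigma> i (kind v))} = R * z i"
      using assms card_up(2)[OF assms(1), of "\<lambda>j. odd (\<sigma> (Suc i) j - \<sigma> i (kind v))"]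
      by (simp add: i_def enabled_def del: even_diff)
    moreover have "(1 + lam) * (real (z i) + real D) \<le> 2 * real (z i)"
      using z_relay[of "i - 1"] True lam mult_right_mono[of "1 + lam" 2 "real (z i)"]
      by (cases "i = 0") (auto simp: D_def)
    then have "real R * ((1 + lam) * (real (z i) + real D)) \<le> real R * (2 * real (z i))"
      by (rule mult_left_mono) simp
    ultimately show ?thesis by (simp add: deg field_simps)
  next
    case False
    define K where "K = card {j. j < R \<and> odd (\<sigma> (Suc i) j - \<sigma> i (kind v))}"
    have "card {u \<in> up v. odd (\<sigma> (Suc i) (kind u) - \<sigma> i (kind v))} = z i * K"
      using False card_up(2)[OF assms(1), of "\<lambda>j. odd (\<sigma> (Suc i) j - \<sigma> i (kind v))"]
      by (simp add: i_def K_def del: even_diff)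
    moreover have "J + s \<le> K"
      using assms(2) False by (simp add: enabled_def i_def K_def del: even_diff)
    then have "real (J + s) * real (z i) \<le> real K * real (z i)"
      by (intro mult_right_mono) (auto simp flip: of_nat_add)
    moreover have "(1 + lam) * real R * (real (z i) + real D) \<le> 2 * real (J + s) * real (z i)"
      using z_gain[of "i - 1"] False by (cases "i = 0") (auto simp: D_def)
    ultimately show ?thesis by (simp add: deg field_simps)
  qed
  ultimately show ?thesis unfolding switchable_def by (meson of_nat_mono order_trans)
qed

lemma coloring_bump:
  "coloring (bump \<sigma> i {k}) v =
     (if layer v = i \<and> kind v = k then opposite (coloring \<sigma> v) else coloring \<sigma> v)"
  by (auto simp: coloring_def bump_def paint_def)

text \<open>One token move is carried out by all \<open>W\<close> nodes of that kind in that layer.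
  The bound counts only the moves of kind 0 in the bottom layer.\<close>

lemma reach_switches:
  assumes "reach H \<sigma> \<tau>"
  shows "\<exists>vs. valid_switches P lam V E (coloring \<sigma>) vs \<and> foldl switch (coloring \<sigma>) vs = coloring \<tau> \<and>
     int W * (\<tau> 0 0 - \<sigma> 0 0) \<le> int (length vs)"
  using assms
proof induction
  case refl
  show ?case by (rule exI[of _ "[]"]) simp
next
  case (step \<tau> i k)
  then obtain vs where vs: "valid_switches P lam V E (coloring \<sigma>) vs"
    "foldl switch (coloring \<sigma>) vs = coloring \<tau>" "int W * (\<tau> 0 0 - \<sigma> 0 0) \<le> int (length vs)"
    by blast
  define ws where "ws = map (\<lambda>x. node i x k) [0..<W]"
  have set_ws: "set ws = {v. layer v = i \<and> kind v = k}"
  proof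
    show "{v. layer v = i \<and> kind v = k} \<subseteq> set ws"
    proof
      fix v assume "v \<in> {v. layer v = i \<and> kind v = k}"
      then have "v = node i (place v) k" using node_eta[of v] by simp
      then show "v \<in> set ws" using place_less[of v] by (auto simp: ws_def)
    qed
  qed (use step.hyps in \<open>auto simp: ws_def\<close>)
  have "valid_switches P lam V E (coloring \<tau>) ws \<and>
      foldl switch (coloring \<tau>) ws = (\<lambda>v. if v \<in> set ws then opposite (coloring \<tau> v) else coloring \<tau> v)"
  proof (rule valid_switches_independent)
    show "distinct ws" unfolding ws_def distinct_map
      by (auto intro!: inj_on_inverseI[where g = place] simp: step.hyps)
    show "set ws \<subseteq> V" using step.hyps by (auto simp: set_ws in_V_iff)
    show "switchable P lam E (coloring \<tau>) v" if "v \<in> set ws" for v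
      using that step.hyps by (intro enabled_switchable) (auto simp: set_ws)
    show "{u, v} \<notin> E" if "u \<in> set ws" "v \<in> set ws" for u v
    proof
      assume "{u, v} \<in> E"
      then obtain a b where "{u, v} = {a, b}" "layer b = Suc (layer a)"
        unfolding E_def using adj_layer by blast
      then show False using that by (auto simp: set_ws doubleton_eq_iff)
    qed
  qed
  moreover have "(\<lambda>v. if v \<in> set ws then opposite (coloring \<tau> v) else coloring \<tau> v) = coloring (bump \<tau> i {k})"
    by (auto simp: fun_eq_iff coloring_bump set_ws)
  moreover have "int W * (bump \<tau> i {k} 0 0 - \<sigma> 0 0) \<le> int W * (\<tau> 0 0 - \<sigma> 0 0) + int W"
    by (auto simp: bump_def algebra_simps)
  moreover have "length ws = W" by (simp add: ws_def)
  ultimately show ?case using vs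
    by (intro exI[of _ "vs @ ws"]) (auto simp: valid_switches_append)
qed

lemma switches_rounds:
  assumes H: "H = 2 * Suc b + Q" and top: "top (Suc b) (int U) \<le> int Q"
  shows "\<exists>col vs. valid_switches P lam V E col vs \<and> real W * (real U / rate - 3) \<le> real (length vs)"
proof -
  obtain vs where vs: "valid_switches P lam V E (coloring (canon Q (Suc b) 0)) vs"
    "int W * (canon Q (Suc b) (int U) 0 0 - canon Q (Suc b) 0 0 0) \<le> int (length vs)"
    using reach_switches[OF reach_canon_rounds[OF top, folded H]] by blast
  \<comment> \<open>The 3 bounds the index at round 0.\<close>
  have "real U / rate - 3 \<le> real_of_int (idx 0 (int U) - idx 0 0)"
    using idx_bounds(2)[of "int U"] idx_bounds(1)[of 0] by simp
  then have "real W * (real U / rate - 3) \<le> real W * real_of_int (idx 0 (int U) - idx 0 0)"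
    by (rule mult_left_mono) simp
  also have "\<dots> = real_of_int (int W * (idx 0 (int U) - idx 0 0))" by simp
  also have "\<dots> \<le> real_of_int (int (length vs))"
    using vs(2) R_pos unfolding of_int_le_iff by (simp add: relay_def)
  finally have "real W * (real U / rate - 3) \<le> real (length vs)" by simp
  with vs(1) show ?thesis by blast
qed

end

section \<open>Degrees and growth rates\<close>

text \<open>
  Layer widths are built from the bottom, since rounding up then costs only an additive error of 1
  per layer.
\<close>

fun width :: "real \<Rightarrow> real \<Rightarrow> nat \<Rightarrow> nat" where
  "width p q 0 = 1"
| "width p q (Suc i) = nat \<lceil>real (width p q i) / (if even (Suc i) then p else q)\<rceil>"

lemma width_pos: "0 < p \<Longrightarrow> 0 < q \<Longrightarrow> 0 < width p q i"
  by (induction i) auto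

declare width.simps(2) [simp del]

lemma width_Suc_bounds:
  fixes p q i
  defines "d \<equiv> (if even (Suc i) then p else q)"
  assumes "0 < p" "0 < q"
  shows "real (width p q i) \<le> d * real (width p q (Suc i))"
    and "real (width p q (Suc i)) \<le> real (width p q i) / d + 1"
proof -
  have d: "0 < d" using assms by (simp add: d_def)
  define w where "w = real (width p q i) / d"
  have w: "0 \<le> w" using d by (simp add: w_def)
  have e: "real (width p q (Suc i)) = of_int \<lceil>w\<rceil>"
    using w by (simp add: width.simps(2) w_def d_def)
  have "w \<le> real (width p q (Suc i))" unfolding e by simp
  then show "real (width p q i) \<le> d * real (width p q (Suc i))"
    using d by (simp add: w_def field_simps)
  show "real (width p q (Suc i)) \<le> real (width p q i) / d + 1"
    unfolding e w_def[symmetric] by linarith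
qed

lemma width_mono:
  assumes "0 < p" "p \<le> 1" "0 < q" "q \<le> 1" "i \<le> j"
  shows "width p q i \<le> width p q j"
  using assms(5)
proof (induction rule: dec_induct)
  case (step j)
  let ?d = "if even (Suc j) then p else q"
  have "real (width p q j) \<le> ?d * real (width p q (Suc j))"
    using width_Suc_bounds(1)[of p q j] assms by simp
  also have "\<dots> \<le> 1 * real (width p q (Suc j))"
    using assms by (intro mult_right_mono) auto
  finally show ?case using step by simp
qed simp

lemma width_growth:
  fixes p q :: real
  defines "\<theta> \<equiv> 1 / (p * q)"
  defines "a \<equiv> (1 / p + 1) / (\<theta> - 1)"
  assumes "0 < p" "p < 1" "0 < q" "q < 1"
  shows "real (width p q (2 * i)) \<le> (1 + a) * \<theta> ^ i"
proof -
  have "p * q < 1 * 1" using assms by (intro mult_strict_mono) auto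
  then have th: "1 < \<theta>" using assms by (simp add: \<theta>_def field_simps)
  \<comment> \<open>As \<open>(\<theta> - 1) * a = 1 / p + 1\<close>, adding \<open>a\<close>
    absorbs the rounding errors of a pair of layers and leaves pure growth by
    \<open>\<theta>\<close>.\<close>
  have "real (width p q (2 * i)) + a \<le> (1 + a) * \<theta> ^ i"
  proof (induction i)
    case (Suc i)
    have "real (width p q (Suc (2 * i))) \<le> real (width p q (2 * i)) / q + 1"
      using width_Suc_bounds(2)[of p q "2 * i"] assms by simp
    then have "real (width p q (Suc (2 * i))) / p \<le> (real (width p q (2 * i)) / q + 1) / p"
      using assms by (intro divide_right_mono) auto
    moreover have "real (width p q (Suc (Suc (2 * i)))) \<le> real (width p q (Suc (2 * i))) / p + 1"
      using width_Suc_bounds(2)[of p q "Suc (2 * i)"] assms by simp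
    ultimately have "real (width p q (2 * Suc i)) \<le> \<theta> * real (width p q (2 * i)) + (1 / p + 1)"
      by (simp add: \<theta>_def add_divide_distrib mult.commute)
    moreover have "(\<theta> - 1) * a = 1 / p + 1"
      using th by (simp add: a_def)
    ultimately have "real (width p q (2 * Suc i)) + a \<le> \<theta> * (real (width p q (2 * i)) + a)"
      by (simp add: algebra_simps)
    also have "\<dots> \<le> \<theta> * ((1 + a) * \<theta> ^ i)"
      using Suc th by (intro mult_left_mono) auto
    finally show ?case by (simp add: mult_ac)
  qed simp
  moreover have "0 \<le> a" using th assms by (simp add: a_def)
  ultimately show ?thesis by linarith
qed

section \<open>From layers to the exponent\<close>

definition runs :: "process \<Rightarrow> real \<Rightarrow> real \<Rightarrow> real \<Rightarrow> bool" where
  "runs P lam n m \<longleftrightarrow> (\<exists>(V :: nat set) E col vs. simple_graph V E \<and> real (card V) \<le> n \<and>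
     (\<forall>v\<in>V. degree E v > 0) \<and> valid_switches P lam V E col vs \<and> m \<le> real (length vs))"

lemma runs_mono: "runs P lam n m \<Longrightarrow> n \<le> n' \<Longrightarrow> m' \<le> m \<Longrightarrow> runs P lam n' m'"
  unfolding runs_def by (meson order_trans)

lemma runs_blocks:
  fixes lam phi :: real and J s :: nat
  defines "r \<equiv> real (J + 2 * s) / real J"
    and "\<theta> \<equiv> (1 - phi) / phi * ((1 + lam) / (1 - lam))"
  assumes lam: "0 < lam" "lam < 1" and phi: "0 < phi" "phi < 1 / 2"
    and J: "0 < J" and s: "0 < s" and r: "r \<le> (1 - phi) / (lam + phi)"
  obtains K L :: real where "0 < K" "0 < L"
    "\<And>b W. K * \<theta> ^ b \<le> real W \<Longrightarrow> runs P lam (L * (real b + 1) * real W) (real W * (r ^ b - 4))"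
proof -
  interpret schedule J s by standard (rule J)
  have rate: "rate = r" by (simp add: rate_def R_def r_def)
  have r1: "1 < r" using J s by (simp add: r_def)
  define p q where "p = (1 - lam) / (1 + lam)" and "q = phi / (1 - phi)"
  have pq: "0 < p" "p < 1" "0 < q" "q < 1" using lam phi by (auto simp: p_def q_def)
  have th: "\<theta> = 1 / (p * q)" by (simp add: \<theta>_def p_def q_def mult.commute)
  have th1: "1 \<le> \<theta>" using pq mult_strict_mono[of p 1 q 1] by (simp add: th field_simps)
  define C where "C = 1 + (1 / p + 1) / (\<theta> - 1)"
  \<comment> \<open>This bounds the index required of the chain independently of \<open>b\<close>:
    \<open>top_bound\<close> gives the quotient, and the 1 comes from
    \<open>U \<le> r ^ Suc b\<close>.\<close>
  define Q where "Q = nat \<lceil>1 + 3 * r / (r - 1)\<rceil>"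
  have grow: "real (width p q (2 * i)) \<le> C * \<theta> ^ i" for i
    using width_growth[OF pq] by (simp add: C_def th)
  have C: "1 \<le> C" using grow[of 0] by simp
  \<comment> \<open>The graph has \<open>Suc b + Q\<close> pairs of layers; the growth over the
    \<open>Suc Q\<close> pairs beyond \<open>b\<close> goes into \<open>K\<close>.\<close>
  define K where "K = real R * C * \<theta> ^ Suc Q"
  define L where "L = (2 * real Q + 3) * real R"
  show thesis
  proof
    show "0 < K" "0 < L" using R_pos C th1 by (auto simp: K_def L_def)
    fix b W :: nat
    assume W: "K * \<theta> ^ b \<le> real W"
    \<comment> \<open>The chain gets \<open>2 * Q\<close> layers so that \<open>H\<close> is even
      and \<open>width_growth\<close> bounds all widths.\<close>
    define H where "H = 2 * Suc b + 2 * Q"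
    have G: "layered_graph J s lam W H (width p q)"
    proof unfold_locales
      show "0 < lam" "lam < 1" "0 < H" using lam by (auto simp: H_def)
      show "0 < width p q i" for i using width_pos pq by simp
      show "R * width p q i \<le> W" if "i < H" for i
      proof -
        have "width p q i \<le> width p q (2 * (Suc b + Q))"
          using that pq by (intro width_mono) (auto simp: H_def)
        then have "real (width p q i) \<le> C * \<theta> ^ (Suc b + Q)"
          using grow[of "Suc b + Q"] by linarith
        then have "real R * real (width p q i) \<le> real R * (C * \<theta> ^ (Suc b + Q))"
          by (rule mult_left_mono) simp
        also have "\<dots> = K * \<theta> ^ b" by (simp add: K_def power_add)
        also note W
        finally show ?thesis by (simp flip: of_nat_mult)
      qed
      fix i
      note wb = width_Suc_bounds(1)[OF pq(1,3), of i]
      let ?z = "real (width p q i)" and ?z' = "real (width p q (Suc i))"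
      show "(1 + lam) * (?z' + ?z) \<le> 2 * ?z'" if "even (Suc i)"
      proof -
        have "?z \<le> p * ?z'" using wb that by simp
        then have "(1 + lam) * ?z \<le> (1 + lam) * (p * ?z')" using lam by (intro mult_left_mono) auto
        also have "\<dots> = (1 - lam) * ?z'" using lam by (simp add: p_def)
        finally show ?thesis by (simp add: algebra_simps)
      qed
      show "(1 + lam) * real R * (?z' + ?z) \<le> 2 * real (J + s) * ?z'" if "odd (Suc i)"
      proof -
        have "?z \<le> q * ?z'" using wb that by simp
        then have "?z' + ?z \<le> ?z' / (1 - phi)" using phi by (simp add: q_def field_simps)
        then have "(1 + lam) * real R * (?z' + ?z) \<le> (1 + lam) * real R * (?z' / (1 - phi))"
          using lam by (intro mult_left_mono) auto
        also have "\<dots> = (1 + lam) / (1 - phi) * real R * ?z'" by simp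
        also have "(1 + lam) / (1 - phi) * real R \<le> 2 * real (J + s)"
        proof -
          \<comment> \<open>This is the bound on \<open>r\<close>; adding
            \<open>(1 - phi) * R\<close> to both sides gives the gain condition.\<close>
          have "(lam + phi) * real R \<le> (1 - phi) * real J"
            using r lam phi J by (simp add: r_def R_def field_simps)
          then have "(1 + lam) * real R \<le> (1 - phi) * (real R + real J)"
            by (simp add: algebra_simps)
          moreover have "real R + real J = 2 * real (J + s)" by (simp add: R_def)
          ultimately show ?thesis using phi by (simp add: field_simps)
        qed
        finally show ?thesis by (simp add: mult_right_mono)
      qed
    qed
    interpret layered_graph J s lam P W H "width p q" by (rule G)
    \<comment> \<open>Up to this many rounds the demand on the chain stays bounded. The rounding
      costs at most 1 after division by \<open>r\<close>; with the 3 of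
      \<open>switches_rounds\<close> this makes the 4.\<close>
    define U where "U = nat \<lfloor>r ^ Suc b\<rfloor>"
    have rb: "0 < r ^ Suc b" using r1 by simp
    have U: "real U \<le> r ^ Suc b" "r ^ Suc b - 1 \<le> real U"
      using rb by (auto simp: U_def)
    have "real_of_int (local.top (Suc b) (int U)) \<le> real U / r ^ Suc b + 3 * r / (r - 1)"
      using top_bound[of "Suc b" "int U"] r1 by (simp add: rate)
    also have "real U / r ^ Suc b \<le> 1" using U(1) rb by (simp add: divide_le_eq)
    also have "1 + 3 * r / (r - 1) \<le> real Q" by (simp add: Q_def real_nat_ceiling_ge)
    finally have "local.top (Suc b) (int U) \<le> int (2 * Q)" by simp
    then obtain col vs where vs: "valid_switches P lam V E col vs" "real W * (real U / r - 3) \<le> real (length vs)"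
      using switches_rounds[of b "2 * Q" U] by (auto simp: H_def rate)
    have "r ^ b - 1 \<le> (r ^ Suc b - 1) / r" using r1 by (simp add: field_simps)
    also have "\<dots> \<le> real U / r" using U(2) r1 by (intro divide_right_mono) auto
    finally have "real W * (r ^ b - 4) \<le> real W * (real U / r - 3)"
      by (intro mult_left_mono) auto
    moreover have "real (card V) \<le> L * (real b + 1) * real W"
    proof -
      have "2 * real b + 3 + 2 * real Q \<le> (2 * real Q + 3) * (real b + 1)"
        by (simp add: algebra_simps)
      then have "(2 * real b + 3 + 2 * real Q) * (real W * real R)
          \<le> (2 * real Q + 3) * (real b + 1) * (real W * real R)"
        by (rule mult_right_mono) simp
      moreover have "real (card V) = (real H + 1) * real W * real R" by (simp add: V_def algebra_simps)
      moreover have "real H + 1 = 2 * real b + 3 + 2 * real Q" by (simp add: H_def)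
      ultimately show ?thesis by (simp add: L_def mult_ac)
    qed
    ultimately show "runs P lam (L * (real b + 1) * real W) (real W * (r ^ b - 4))"
      unfolding runs_def using simple_graph_E degree_pos vs by (meson order_trans)
  qed
qed

text \<open>Take \<open>b\<close> about \<open>(1 - \<delta>) * ln n / ln \<theta>\<close> and
  \<open>W\<close> about \<open>n / (L * (b + 1))\<close>. The loss \<open>\<delta>\<close> in the
  exponent pays for the logarithmic factor \<open>b + 1\<close>.\<close>

lemma runs_asymptotic:
  fixes K L \<theta> r \<delta> :: real
  assumes K: "0 < K" and L: "0 < L" and th: "1 < \<theta>" and r: "1 < r" and \<delta>: "0 < \<delta>" "\<delta> < 1"
    and runs: "\<And>b W. K * \<theta> ^ b \<le> real W \<Longrightarrow> runs P lam (L * (real b + 1) * real W) (real W * (r ^ b - 4))"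
  shows "\<forall>\<^sub>F n :: nat in sequentially.
    runs P lam (real n) (1 / (2 * r) * real n powr ((1 - \<delta>) * (1 + ln r / ln \<theta>)))"
proof -
  define f where "f = ln r / ln \<theta>"
  have l: "0 < ln \<theta>" and f: "0 < f" using th r by (auto simp: f_def)
  \<comment> \<open>The factor \<open>K + 1\<close> gives both the width condition with
    \<open>K\<close> and \<open>W\<close> at least \<open>n powr (1 - \<delta>)\<close>.\<close>
  have "\<forall>\<^sub>F n :: nat in sequentially. (K + 1) * real n powr (1 - \<delta>)
      \<le> real n / (L * ((1 - \<delta>) * ln (real n) / ln \<theta> + 1)) - 1"
    using K L l \<delta> by real_asymp
  \<comment> \<open>With \<open>8 * r\<close>, subtracting 4 costs at most half of the lower bound
    on \<open>r ^ b\<close>.\<close>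
  moreover have "\<forall>\<^sub>F n :: nat in sequentially. 8 * r \<le> real n powr ((1 - \<delta>) * f)"
  proof -
    have "0 < (1 - \<delta>) * f" using \<delta> f by simp
    then show ?thesis by real_asymp
  qed
  moreover have "\<forall>\<^sub>F n :: nat in sequentially. 1 \<le> n" by (rule eventually_ge_at_top)
  ultimately show ?thesis
  proof eventually_elim
    case (elim n)
    then have n: "1 \<le> real n" by simp
    define y where "y = (1 - \<delta>) * ln (real n) / ln \<theta>"
    define b where "b = nat \<lfloor>y\<rfloor>"
    define W where "W = nat \<lfloor>real n / (L * (real b + 1))\<rfloor>"
    have y: "0 \<le> y" using n l \<delta> by (simp add: y_def)
    then have b: "real b \<le> y" "y - 1 \<le> real b" by (auto simp: b_def)
    have Lb: "0 < L * (real b + 1)" using L by simp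
    have "0 \<le> real n / (L * (real b + 1))" using Lb by simp
    then have W: "real W \<le> real n / (L * (real b + 1))" "real n / (L * (real b + 1)) - 1 \<le> real W"
      by (auto simp: W_def)
    have "real n / (L * (y + 1)) \<le> real n / (L * (real b + 1))"
      using b L Lb n y by (intro divide_left_mono mult_left_mono mult_pos_pos) auto
    then have W': "(K + 1) * real n powr (1 - \<delta>) \<le> real W"
      using elim(1) W(2) unfolding y_def by linarith
    have "\<theta> ^ b = \<theta> powr real b" using th by (simp add: powr_realpow)
    also have "\<dots> \<le> \<theta> powr y" using b th by (intro powr_mono) auto
    also have "\<dots> = real n powr (1 - \<delta>)" using n l th by (simp add: powr_def y_def)
    finally have "K * \<theta> ^ b \<le> K * real n powr (1 - \<delta>)" using K by simp
    also have "\<dots> \<le> (K + 1) * real n powr (1 - \<delta>)" by (intro mult_right_mono) auto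
    finally have "K * \<theta> ^ b \<le> real W" using W' by linarith
    then have "runs P lam (L * (real b + 1) * real W) (real W * (r ^ b - 4))" by (rule runs)
    moreover have "L * (real b + 1) * real W \<le> real n" using W(1) Lb by (simp add: field_simps)
    moreover have "1 / (2 * r) * real n powr ((1 - \<delta>) * (1 + f)) \<le> real W * (r ^ b - 4)"
    proof -
      have "real n powr ((1 - \<delta>) * f) / r = r powr (y - 1)"
        using n l r th by (simp add: powr_def y_def f_def exp_diff algebra_simps)
      also have "\<dots> \<le> r powr real b" using b r by (intro powr_mono) auto
      also have "\<dots> = r ^ b" using r by (simp add: powr_realpow)
      finally have "real n powr ((1 - \<delta>) * f) / r \<le> r ^ b" .
      moreover have "4 \<le> real n powr ((1 - \<delta>) * f) / (2 * r)" using elim(2) r by (simp add: field_simps)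
      ultimately have rb: "real n powr ((1 - \<delta>) * f) / (2 * r) \<le> r ^ b - 4"
        by (simp add: field_simps)
      have "1 * real n powr (1 - \<delta>) \<le> (K + 1) * real n powr (1 - \<delta>)"
        using K by (intro mult_right_mono) auto
      then have "real n powr (1 - \<delta>) \<le> real W" using W' by linarith
      then have "real n powr (1 - \<delta>) * (real n powr ((1 - \<delta>) * f) / (2 * r)) \<le> real W * (r ^ b - 4)"
        using rb r by (intro mult_mono) auto
      then show ?thesis by (simp add: distrib_left powr_add)
    qed
    ultimately show ?case unfolding f_def[symmetric] by (rule runs_mono)
  qed
qed

lemma rational_rate:
  fixes a b :: real
  assumes "1 \<le> a" "a < b"
  obtains J s :: nat where "0 < J" "0 < s" "a < real (J + 2 * s) / real J" "real (J + 2 * s) / real J < b"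
proof -
  \<comment> \<open>The rate is \<open>1 + 2 * t\<close> with \<open>t = s / J\<close>.\<close>
  obtain t where t: "t \<in> \<rat>" "(a - 1) / 2 < t" "t < (b - 1) / 2"
    using Rats_dense_in_real[of "(a - 1) / 2" "(b - 1) / 2"] assms by auto
  obtain s J :: nat where J: "J \<noteq> 0" "\<bar>t\<bar> = real s / real J" using t(1) by (rule Rats_abs_nat_div_natE)
  have "0 < t" using t assms by simp
  with J have t': "t = real s / real J" "0 < s" by (auto intro: gr0I)
  have "real (J + 2 * s) / real J = 1 + 2 * t" using J by (simp add: t'(1) field_simps)
  then show thesis using that[of J s] J t t'(2) by simp
qed

text \<open>The ratio vanishes at the right end of the interval, so the midpoint is taken.
  Positivity makes the optimal \<open>\<rho>\<close> in the theorem exceed 1, leaving room for a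
  rational rate below it.\<close>

lemma f_hat_pos:
  fixes lam :: real
  assumes "0 < lam" "lam < 1"
  shows "0 < f_hat lam"
proof -
  define phi where "phi = (1 - lam) / 4"
  have phi: "0 < phi" "phi \<le> (1 - lam) / 2" using assms by (auto simp: phi_def)
  have "1 < (1 - phi) / (lam + phi)" using assms by (simp add: phi_def field_simps)
  then have "0 < exponent_ratio lam phi"
    unfolding exponent_ratio_def
    using exponent_ratio_denominator_pos[OF assms phi] by (intro divide_pos_pos) auto
  also have "\<dots> \<le> f_hat lam" using phi by (intro f_hat_is_maximum(2)[OF assms]) auto
  finally show ?thesis .
qed

theorem theorem3:
  fixes lam eps :: real and P :: process
  assumes "0 < lam" and "lam < 1" and "0 < eps"
  shows "\<exists>c>0. \<forall>\<^sub>F n :: nat in sequentially.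
           \<exists>(V :: nat set) (E :: nat set set) (col :: nat \<Rightarrow> color) (vs :: nat list).
             simple_graph V E \<and> card V \<le> n \<and> (\<forall>v\<in>V. degree E v > 0) \<and>
             valid_switches P lam V E col vs \<and>
             real (length vs) \<ge> c * real n powr (1 + f_hat lam - eps)"
proof -
  obtain phi where phi: "0 < phi" "phi \<le> (1 - lam) / 2" and fphi: "f_hat lam = exponent_ratio lam phi"
    using f_hat_is_maximum(1)[OF assms(1,2)] by auto
  define \<theta> where "\<theta> = (1 - phi) / phi * ((1 + lam) / (1 - lam))"
  define \<rho> where "\<rho> = (1 - phi) / (lam + phi)"
  have l: "0 < ln \<theta>" using exponent_ratio_denominator_pos[OF assms(1,2) phi] by (simp add: \<theta>_def)
  have "0 < \<theta>" using phi assms by (simp add: \<theta>_def)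
  then have th: "1 < \<theta>" using l by simp
  have fh: "f_hat lam = ln \<rho> / ln \<theta>" by (simp add: fphi exponent_ratio_def \<theta>_def \<rho>_def)
  then have "0 < ln \<rho>" using f_hat_pos[OF assms(1,2)] l by (simp add: zero_less_divide_iff)
  moreover have "0 < \<rho>" using phi assms by (simp add: \<rho>_def)
  ultimately have rho: "1 < \<rho>" by simp
  \<comment> \<open>A rate above \<open>a\<close> loses less than \<open>eps / 2\<close> in
    \<open>ln r / ln \<theta>\<close>; the maximum with 1 meets the hypothesis of
    \<open>rational_rate\<close>.\<close>
  define a where "a = max 1 (\<rho> * exp (- (eps / 2 * ln \<theta>)))"
  have "exp (- (eps / 2 * ln \<theta>)) < 1" using assms l by simp
  then have a: "1 \<le> a" "a < \<rho>" using rho by (auto simp: a_def)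
  obtain J s :: nat where J: "0 < J" "0 < s"
    and ab: "a < real (J + 2 * s) / real J" "real (J + 2 * s) / real J < \<rho>"
    using rational_rate[OF a] .
  define r where "r = real (J + 2 * s) / real J"
  have r: "1 < r" "r < \<rho>" "\<rho> * exp (- (eps / 2 * ln \<theta>)) < r"
    using a ab by (auto simp: r_def a_def)
  obtain K L :: real where KL: "0 < K" "0 < L"
    "\<And>b W. K * \<theta> ^ b \<le> real W \<Longrightarrow> runs P lam (L * (real b + 1) * real W) (real W * (r ^ b - 4))"
    using runs_blocks[of lam phi J s P] assms phi J r(2) unfolding r_def \<theta>_def \<rho>_def by auto
  have "ln \<rho> - eps / 2 * ln \<theta> = ln (\<rho> * exp (- (eps / 2 * ln \<theta>)))"
    using rho by (simp add: ln_mult)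
  also have "\<dots> < ln r" using r rho by simp
  finally have "(ln \<rho> - eps / 2 * ln \<theta>) / ln \<theta> < ln r / ln \<theta>"
    using l by (rule divide_strict_right_mono)
  then have f_ge: "f_hat lam - eps / 2 < ln r / ln \<theta>" using l by (simp add: fh diff_divide_distrib)
  have f_le: "ln r / ln \<theta> \<le> f_hat lam" using r rho l unfolding fh by (intro divide_right_mono) auto
  \<comment> \<open>This spends the other \<open>eps / 2\<close>; the summand \<open>eps\<close> in
    the denominator keeps \<open>\<delta>\<close> below 1 for large \<open>eps\<close>.\<close>
  define \<delta> where "\<delta> = eps / (2 * (1 + f_hat lam) + eps)"
  have fp: "0 < f_hat lam" by (rule f_hat_pos[OF assms(1,2)])
  have \<delta>: "0 < \<delta>" "\<delta> < 1" using assms(3) fp by (auto simp: \<delta>_def)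
  have "\<delta> * (1 + ln r / ln \<theta>) \<le> \<delta> * (1 + f_hat lam)" using \<delta> f_le by (intro mult_left_mono) auto
  also have "\<dots> \<le> eps / 2" using assms(3) fp by (simp add: \<delta>_def field_simps)
  finally have ex: "1 + f_hat lam - eps \<le> (1 - \<delta>) * (1 + ln r / ln \<theta>)"
    using f_ge by (simp only: left_diff_distrib mult_1_left)
  have "\<forall>\<^sub>F n :: nat in sequentially.
      runs P lam (real n) (1 / (2 * r) * real n powr ((1 - \<delta>) * (1 + ln r / ln \<theta>)))"
    by (rule runs_asymptotic[OF KL(1,2) th r(1) \<delta> KL(3)])
  moreover have "\<forall>\<^sub>F n :: nat in sequentially. 1 \<le> n" by (rule eventually_ge_at_top)
  ultimately have "\<forall>\<^sub>F n :: nat in sequentially.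
      runs P lam (real n) (1 / (2 * r) * real n powr (1 + f_hat lam - eps))"
  proof eventually_elim
    case (elim n)
    have "1 / (2 * r) * real n powr (1 + f_hat lam - eps)
        \<le> 1 / (2 * r) * real n powr ((1 - \<delta>) * (1 + ln r / ln \<theta>))"
      using ex elim(2) r by (intro mult_left_mono powr_mono) auto
    then show ?case using elim(1) by (rule runs_mono[rotated 2]) simp
  qed
  then show ?thesis using r(1) unfolding runs_def by (intro exI[of _ "1 / (2 * r)"]) simp
qed

end
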